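(* Let $\mathcal E_1=(Z_1,\sigma_1,\kappa_1)$ and $\mathcal E_2=(Z_2,\sigma_2,\kappa_2)$ be weighted dual skeletons, with sets of neutral distributions $\Sigma_1$ and $\Sigma_2$, and let $\Sigma_{12}$ be the set of neutral distributions of the Cartesian product $\mathcal E_1\times\mathcal E_2$. If $\pi_1\in\Sigma_1$ and $\pi_2\in\Sigma_2$, then $$\pi_1\otimes\pi_2\in\Sigma_{12}.$$
   Context: A weighted dual skeleton is a triple $(Z,\sigma,\kappa)$ where $Z$ is a non-empty finite set, $\sigma:Z\to Z$ satisfies $\sigma^2=\mathrm{id}$, and $\kappa:Z\to\mathbb R_{>0}$ satisfies $\kappa(z)\kappa(\sigma(z))=K$ for all $z\in Z$, with $K>0$ constant. The Cartesian product is $\mathcal E_1\times\mathcal E_2=(Z_1\times Z_2,\sigma_1\times\sigma_2,\kappa_1\otimes\kappa_2)$ with $(\sigma_1\times\sigma_2)(z,w)=(\sigma_1(z),\sigma_2(w))$ and $(\kappa_1\otimes\kappa_2)(z,w)=\kappa_1(z)\kappa_2(w)$. With $r_z=(\kappa(\sigma(z))/\kappa(z))^{1/2}$, a probability vector $\pi$ on $Z$ is neutral if $\pi_z/\pi_{\sigma(z)}=r_z$ for every $z\in Z$; in the linear form that makes sense on the closed simplex, $\sqrt{\kappa(z)}\,\pi_z=\sqrt{\kappa(\sigma(z))}\,\pi_{\sigma(z)}$ for every $z\in Z$. The tensor product of probability vectors $\pi_1$ on $Z_1$ and $\pi_2$ on $Z_2$ is the probability vector on $Z_1\times Z_2$ given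 by $(\pi_1\otimes\pi_2)_{(z,w)}=\pi_{1,z}\,\pi_{2,w}$. *)

theory Defs
  imports Complex_Main
begin

(* The functions are total on 'a; only their values on Z are meaningful. *)
record 'a skeleton =
  Z :: "'a set"
  dual :: "'a \<Rightarrow> 'a"
  weight :: "'a \<Rightarrow> real"

definition weighted_dual_skeleton :: "'a skeleton \<Rightarrow> bool" where
  "weighted_dual_skeleton E \<longleftrightarrow>
     finite (Z E) \<and> Z E \<noteq> {} \<and>
     (\<forall>z\<in>Z E. dual E z \<in> Z E \<and> dual E (dual E z) = z) \<and>
     (\<forall>z\<in>Z E. weight E z > 0) \<and>
     (\<exists>K>0. \<forall>z\<in>Z E. weight E z * weight E (dual E z) = K)"

definition cart_prod :: "'a skeleton \<Rightarrow> 'b skeleton \<Rightarrow> ('a \<times> 'b) skeleton" where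
  "cart_prod E1 E2 =
     \<lparr>Z = Z E1 \<times> Z E2,
      dual = (\<lambda>(z, w). (dual E1 z, dual E2 w)),
      weight = (\<lambda>(z, w). weight E1 z * weight E2 w)\<rparr>"

definition prob_vector_on :: "'a set \<Rightarrow> ('a \<Rightarrow> real) \<Rightarrow> bool" where
  "prob_vector_on A p \<longleftrightarrow> (\<forall>z\<in>A. 0 \<le> p z) \<and> (\<Sum>z\<in>A. p z) = 1"

(* Neutrality in its linear form, which makes sense on the closed simplex;
   neutral_iff_ratio below relates it to the ratio form. *)
definition neutral :: "'a skeleton \<Rightarrow> ('a \<Rightarrow> real) \<Rightarrow> bool" where
  "neutral E p \<longleftrightarrow>
     (\<forall>z\<in>Z E. sqrt (weight E z) * p z = sqrt (weight E (dual E z)) * p (dual E z))"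

definition neutral_distributions :: "'a skeleton \<Rightarrow> ('a \<Rightarrow> real) set" where
  "neutral_distributions E = {p. prob_vector_on (Z E) p \<and> neutral E p}"

definition tensor :: "('a \<Rightarrow> real) \<Rightarrow> ('b \<Rightarrow> real) \<Rightarrow> 'a \<times> 'b \<Rightarrow> real" where
  "tensor p q = (\<lambda>(z, w). p z * q w)"

lemma neutral_iff_ratio:
  assumes "weighted_dual_skeleton E" and "\<And>z. z \<in> Z E \<Longrightarrow> p z > 0"
  shows "neutral E p \<longleftrightarrow>
     (\<forall>z\<in>Z E. p z / p (dual E z) = sqrt (weight E (dual E z) / weight E z))"
proof -
  have "sqrt (weight E z) * p z = sqrt (weight E (dual E z)) * p (dual E z) \<longleftrightarrow>
      p z / p (dual E z) = sqrt (weight E (dual E z) / weight E z)" if "z \<in> Z E" for z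
  proof -
    have "weight E z > 0" "p (dual E z) > 0"
      using assms that by (auto simp: weighted_dual_skeleton_def)
    then show ?thesis
      by (simp add: real_sqrt_divide field_simps)
  qed
  then show ?thesis
    by (auto simp: neutral_def)
qed

lemma weighted_dual_skeleton_cart_prod:
  assumes "weighted_dual_skeleton E1" and "weighted_dual_skeleton E2"
  shows "weighted_dual_skeleton (cart_prod E1 E2)"
proof -
  obtain K where K: "K > 0" "\<And>z. z \<in> Z E1 \<Longrightarrow> weight E1 z * weight E1 (dual E1 z) = K"
    using assms(1) by (auto simp: weighted_dual_skeleton_def)
  obtain L where L: "L > 0" "\<And>w. w \<in> Z E2 \<Longrightarrow> weight E2 w * weight E2 (dual E2 w) = L"
    using assms(2) by (auto simp: weighted_dual_skeleton_def)
  have "weight E1 z * weight E2 w * (weight E1 (dual E1 z) * weight E2 (dual E2 w)) = K * L"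
    if "z \<in> Z E1" "w \<in> Z E2" for z w
    using K(2)[OF that(1)] L(2)[OF that(2)] by (metis mult.assoc mult.left_commute)
  moreover have "K * L > 0" using K(1) L(1) by simp
  ultimately have "\<exists>M>0. \<forall>x\<in>Z (cart_prod E1 E2).
      weight (cart_prod E1 E2) x * weight (cart_prod E1 E2) (dual (cart_prod E1 E2) x) = M"
    by (intro exI[of _ "K * L"]) (auto simp: cart_prod_def)
  then show ?thesis
    using assms unfolding weighted_dual_skeleton_def by (auto simp: cart_prod_def)
qed

end

theory Submission
  imports Defs
begin

text \<open>Both conditions defining a neutral distribution are multiplicative. The total mass of
  \<open>tensor p1 p2\<close> factors as the product of the two total masses, and, because the square root
  is multiplicative, so do the two sides of the linear neutrality equation at \<open>(z, w)\<close>: that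
  equation is the product of the neutrality equations at \<open>z\<close> and at \<open>w\<close>. Nothing is divided,
  so distributions on the boundary of the simplex are covered as well.\<close>

lemma prob_vector_on_tensor:
  assumes "prob_vector_on A p" and "prob_vector_on B q"
  shows "prob_vector_on (A \<times> B) (tensor p q)"
proof -
  have "(\<Sum>x\<in>A \<times> B. tensor p q x) = (\<Sum>z\<in>A. p z) * (\<Sum>w\<in>B. q w)"
    by (simp add: tensor_def sum_product sum.cartesian_product)
  then show ?thesis
    using assms by (auto simp: prob_vector_on_def tensor_def)
qed

lemma neutral_tensor:
  assumes "neutral E1 p1" and "neutral E2 p2"
  shows "neutral (cart_prod E1 E2) (tensor p1 p2)"
proof -
  have "sqrt (weight E1 z * weight E2 w) * (p1 z * p2 w) =
      sqrt (weight E1 (dual E1 z) * weight E2 (dual E2 w)) * (p1 (dual E1 z) * p2 (dual E2 w))"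
    if "z \<in> Z E1" "w \<in> Z E2" for z w
  proof -
    have "sqrt (weight E1 z * weight E2 w) * (p1 z * p2 w) =
        (sqrt (weight E1 z) * p1 z) * (sqrt (weight E2 w) * p2 w)"
      by (simp add: real_sqrt_mult)
    also have "\<dots> = (sqrt (weight E1 (dual E1 z)) * p1 (dual E1 z)) *
        (sqrt (weight E2 (dual E2 w)) * p2 (dual E2 w))"
      using assms that by (simp add: neutral_def)
    also have "\<dots> = sqrt (weight E1 (dual E1 z) * weight E2 (dual E2 w)) *
        (p1 (dual E1 z) * p2 (dual E2 w))"
      by (simp add: real_sqrt_mult)
    finally show ?thesis .
  qed
  then show ?thesis
    by (auto simp: neutral_def cart_prod_def tensor_def)
qed

theorem proposition9p4:
  fixes E1 :: "'a skeleton" and E2 :: "'b skeleton"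
    and p1 :: "'a \<Rightarrow> real" and p2 :: "'b \<Rightarrow> real"
  assumes "weighted_dual_skeleton E1" and "weighted_dual_skeleton E2"
    and "p1 \<in> neutral_distributions E1" and "p2 \<in> neutral_distributions E2"
  shows "tensor p1 p2 \<in> neutral_distributions (cart_prod E1 E2)"
proof -
  have "Z (cart_prod E1 E2) = Z E1 \<times> Z E2"
    by (simp add: cart_prod_def)
  then show ?thesis
    using assms(3,4)
    by (simp add: neutral_distributions_def prob_vector_on_tensor neutral_tensor)
qed

end
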